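(* Let $f:\mathbb{R}^m\to\mathbb{R}^m$ be Lipschitz continuous and continuously differentiable, and let $p\ge1$ be an integer. Assume that $\mathcal{C}_p\subset\mathcal{C}_1$ are compact subsets of $\mathbb{R}^m$ that are invariant under the orbits of $f^{(p)}$ and $f$, respectively. In addition, assume that $f^{(p)}$ is sup-mean contractive on $\mathcal{C}_p$. That is, $x\in\mathcal{C}_p$ implies $f^{(p)}(x)\in\mathcal{C}_p$, and $\bar R_{\|\cdot\|}=r_{\|\cdot\|}[f^{(p)}]<0$ for some norm $\|\cdot\|$ on $\mathbb{R}^m$. Then $f$ admits either a unique stable fixed point in $\mathcal{C}_p$ or a stable periodic solution in $\mathcal{C}_1$ of period $d$, where $d$ is a divisor of $p$.
   Context: The dynamical system is $x_{k+1}=f(x_k)$, and $f^{(p)}=f\circ\cdots\circ f$ ($p$ factors) is its $p$-iteration map. Invariance of $\mathcal{C}_1$ under $f$ means $f(\mathcal{C}_1)\subseteq\mathcal{C}_1$, and invariance of $\mathcal{C}_p$ under $f^{(p)}$ means $f^{(p)}(\mathcal{C}_p)\subseteq\mathcal{C}_p$. The reactivity of a map $g$ with respect to $\|\cdot\|$ is $r_{\|\cdot\|}[g]=L_{\|\cdot\|}[g]-1$, where $L_{\|\cdot\|}[g]=\sup_{x\neq y}\frac{\|g(x)-g(y)\|}{\|x-y\|}$ is the Lipschitz constant of $g$; for contractivity on $\mathcal{C}_p$ the supremum is over $x\ne y$ in $\mathcal{C}_p$. For a time-invariant map the sup-mean reactivity $\bar R_{\|\cdot\|}$ equals the reactivity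 of the map, and the map is called sup-mean contractive if it is negative for some norm. A periodic solution of $f$ of period $d$ is an orbit $x^*,f(x^* ),\dots,f^{(d-1)}(x^* )$ of $d$ distinct points with $f^{(d)}(x^* )=x^*$. "Stable" has its usual meaning for fixed points and periodic solutions of the system $x_{k+1}=f(x_k)$.
   Formalization: As stated this fails (f(x,y)=(x/2,2y), C_p=C_1=[-1,1]×{0}: 0 is unstable). Proved for nonempty C_p: stability relative to the states reached from C_p; and stability in all of R^m if C_p lies in the closure of its interior. *)

theory Defs
  imports "HOL-Analysis.Analysis"
begin

(* A norm on the space, independent of the Euclidean norm supplied by the type class. *)
definition is_norm :: "('a::real_vector \<Rightarrow> real) \<Rightarrow> bool" where
  "is_norm N \<longleftrightarrow>
     (\<forall>x. 0 \<le> N x) \<and> (\<forall>x. N x = 0 \<longleftrightarrow> x = 0) \<and>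
     (\<forall>c x. N (c *\<^sub>R x) = \<bar>c\<bar> * N x) \<and> (\<forall>x y. N (x + y) \<le> N x + N y)"

definition continuously_differentiable ::
    "('a::real_normed_vector \<Rightarrow> 'b::real_normed_vector) \<Rightarrow> bool" where
  "continuously_differentiable f \<longleftrightarrow>
     (\<exists>f' :: 'a \<Rightarrow> 'a \<Rightarrow>\<^sub>L 'b.
        (\<forall>x. (f has_derivative blinfun_apply (f' x)) (at x)) \<and> continuous_on UNIV f')"

(* The supremum is taken in ennreal: it may be infinite, and it is 0 when C has no two
   distinct points. *)
definition lipschitz_const_on ::
    "('a::real_vector \<Rightarrow> real) \<Rightarrow> 'a set \<Rightarrow> ('a \<Rightarrow> 'a) \<Rightarrow> ennreal" where
  "lipschitz_const_on N C g =
     (SUP (x, y) \<in> {(x, y). x \<in> C \<and> y \<in> C \<and> x \<noteq> y}. ennreal (N (g x - g y) / N (x - y)))"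

definition reactivity_on ::
    "('a::real_vector \<Rightarrow> real) \<Rightarrow> 'a set \<Rightarrow> ('a \<Rightarrow> 'a) \<Rightarrow> ereal" where
  "reactivity_on N C g = enn2ereal (lipschitz_const_on N C g) - 1"

(* For a time-invariant map the sup-mean reactivity is the reactivity itself. *)
definition sup_mean_contractive_on :: "'a::real_vector set \<Rightarrow> ('a \<Rightarrow> 'a) \<Rightarrow> bool" where
  "sup_mean_contractive_on C g \<longleftrightarrow> (\<exists>N. is_norm N \<and> reactivity_on N C g < 0)"

(* The orbit consists of the d distinct points x, f x, ..., f^(d-1) x. *)
definition periodic_solution :: "('a \<Rightarrow> 'a) \<Rightarrow> 'a \<Rightarrow> nat \<Rightarrow> bool" where
  "periodic_solution f x d \<longleftrightarrow>
     0 < d \<and> (f ^^ d) x = x \<and> inj_on (\<lambda>k. (f ^^ k) x) {..<d}"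

(* All states visited by solutions starting in C: the smallest forward invariant set
   containing C. *)
definition forward_orbits :: "('a \<Rightarrow> 'a) \<Rightarrow> 'a set \<Rightarrow> 'a set" where
  "forward_orbits f C = (\<Union>k. (f ^^ k) ` C)"

(* Lyapunov stability of the solution starting at x, for the system with state space S.
   S = UNIV is stability in the whole space.  For a fixed point this is stability of the fixed
   point; for a periodic solution of a continuous f on an invariant S it does not depend on
   which point of the orbit is taken as x, and agrees with stability of the orbit as a set. *)
definition stable_in :: "'a::metric_space set \<Rightarrow> ('a \<Rightarrow> 'a) \<Rightarrow> 'a \<Rightarrow> bool" where
  "stable_in S f x \<longleftrightarrow>
     x \<in> S \<and>
     (\<forall>e>0. \<exists>\<delta>>0. \<forall>y\<in>S. dist y x < \<delta> \<longrightarrow> (\<forall>k. dist ((f ^^ k) y) ((f ^^ k) x) < e))"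

(* Uniqueness is among all fixed points in C, stable or not. *)
definition unique_stable_fixed_point_in ::
    "'a::metric_space set \<Rightarrow> ('a \<Rightarrow> 'a) \<Rightarrow> 'a set \<Rightarrow> bool" where
  "unique_stable_fixed_point_in S f C \<longleftrightarrow>
     (\<exists>x\<in>C. f x = x \<and> (\<forall>y\<in>C. f y = y \<longrightarrow> y = x) \<and> stable_in S f x)"

definition stable_periodic_solution_in ::
    "'a::metric_space set \<Rightarrow> ('a \<Rightarrow> 'a) \<Rightarrow> 'a set \<Rightarrow> nat \<Rightarrow> bool" where
  "stable_periodic_solution_in S f C d \<longleftrightarrow>
     (\<exists>x. periodic_solution f x d \<and> (\<forall>k<d. (f ^^ k) x \<in> C) \<and> stable_in S f x)"

end

theory Submission
  imports Defs
begin

text \<open>The contraction \<open>f ^^ p\<close> has a unique fixed point \<open>x\<close> in \<open>Cp\<close>, whose least period \<open>d\<close> under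
  \<open>f\<close> divides \<open>p\<close>. Solutions starting in \<open>Cp\<close> converge uniformly to the solution through \<open>x\<close>.
  Each of the finitely many compact sets \<open>(f ^^ j) ` Cp\<close> with \<open>j < p\<close> that contains \<open>x\<close>
  therefore satisfies \<open>(f ^^ j) x = x\<close>, which gives stability on the forward orbits of \<open>Cp\<close>.
  If \<open>Cp\<close> lies in the closure of its interior, the contraction estimate bounds the derivative of
  \<open>f ^^ p\<close> at interior points and, by continuity, at \<open>x\<close>; so \<open>f ^^ p\<close> contracts a full
  neighbourhood of \<open>x\<close> towards \<open>x\<close>.\<close>

section \<open>Periodic points and stability in metric spaces\<close>

lemma funpow_add_apply: "(f ^^ (m + n)) x = (f ^^ m) ((f ^^ n) x)"
  by (simp add: funpow_add)

lemma funpow_multiple_fixed: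
  assumes "(f ^^ p) x = x"
  shows "(f ^^ (p * n)) x = x"
  using assms by (induction n) (auto simp: funpow_add_apply)

text \<open>Take the least positive period \<open>d\<close>. The remainder \<open>p mod d\<close>
  also returns \<open>x\<close> to itself, so minimality makes it zero; a repetition among the first
  \<open>d\<close> points would give a shorter period.\<close>

lemma periodic_point_least_period:
  assumes "0 < p" "(f ^^ p) x = x"
  obtains d where "d dvd p" "periodic_solution f x d"
proof -
  define d where "d = (LEAST d. 0 < d \<and> (f ^^ d) x = x)"
  have d: "0 < d" "(f ^^ d) x = x"
    using LeastI[of "\<lambda>d. 0 < d \<and> (f ^^ d) x = x" p] assms unfolding d_def by auto
  have least: "d \<le> n" if "0 < n" "(f ^^ n) x = x" for n
    unfolding d_def using that by (intro Least_le) auto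
  have "(f ^^ (p mod d)) x = (f ^^ (p mod d)) ((f ^^ (d * (p div d))) x)"
    using funpow_multiple_fixed[OF d(2)] by simp
  also have "\<dots> = x"
    using assms(2) by (simp flip: funpow_add_apply)
  finally have "d dvd p"
    using least[of "p mod d"] mod_less_divisor[OF d(1), of p] by (metis bot_nat_0.not_eq_extremum dvd_eq_mod_eq_0 leD)
  have neq: "(f ^^ i) x \<noteq> (f ^^ j) x" if "i < j" "j < d" for i j
  proof
    assume eq: "(f ^^ i) x = (f ^^ j) x"
    \<comment> \<open>Running both sides for \<open>d - j\<close> more steps turns the repetition
      into a return to \<open>x\<close> at time \<open>d - j + i\<close>, which is positive and
      below \<open>d\<close>.\<close>
    have "(f ^^ (d - j + i)) x = (f ^^ (d - j + j)) x"
      by (simp only: funpow_add_apply eq)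
    then show False
      using that d(2) least[of "d - j + i"] by simp
  qed
  have "inj_on (\<lambda>k. (f ^^ k) x) {..<d}"
  proof (rule inj_onI)
    fix i j assume "i \<in> {..<d}" "j \<in> {..<d}" "(f ^^ i) x = (f ^^ j) x"
    then show "i = j"
      using neq[of i j] neq[of j i] by (cases i j rule: linorder_cases) auto
  qed
  with d \<open>d dvd p\<close> show ?thesis
    by (intro that) (auto simp: periodic_solution_def)
qed

lemma funpow_in:
  assumes "f ` C \<subseteq> C" "x \<in> C"
  shows "(f ^^ k) x \<in> C"
  using assms by (induction k) auto

section \<open>Lipschitz control of solutions and stability on the forward orbits\<close>

lemma funpow_lipschitz_bound:
  fixes f :: "'a::metric_space \<Rightarrow> 'a"
  assumes "L-lipschitz_on UNIV f" "1 \<le> L" "k \<le> n"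
  shows "dist ((f ^^ k) y) ((f ^^ k) x) \<le> L ^ n * dist y x"
proof -
  have "dist ((f ^^ k) y) ((f ^^ k) x) \<le> L ^ k * dist y x"
  proof (induction k)
    case (Suc k)
    have "dist ((f ^^ Suc k) y) ((f ^^ Suc k) x) \<le> L * dist ((f ^^ k) y) ((f ^^ k) x)"
      using lipschitz_onD[OF assms(1), of "(f ^^ k) y" "(f ^^ k) x"] by simp
    also have "\<dots> \<le> L * (L ^ k * dist y x)"
      using Suc assms(2) by (intro mult_left_mono) auto
    finally show ?case by (simp add: mult.assoc)
  qed simp
  also have "\<dots> \<le> L ^ n * dist y x"
    using assms by (intro mult_right_mono power_increasing) auto
  finally show ?thesis .
qed

text \<open>Whole blocks of \<open>p\<close> steps return \<open>x\<close> to itself, and the fewer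
  than \<open>p\<close> remaining steps expand distances by at most \<open>L ^ p\<close>. Control of
  the iterates of \<open>f ^^ p\<close> thus controls the whole solution.\<close>

lemma dist_funpow_le_dist_iterate:
  fixes f :: "'a::metric_space \<Rightarrow> 'a"
  assumes "L-lipschitz_on UNIV f" "1 \<le> L" "0 < p" "(f ^^ p) x = x"
  shows "dist ((f ^^ k) y) ((f ^^ k) x) \<le> L ^ p * dist (((f ^^ p) ^^ (k div p)) y) x"
proof -
  have split: "(f ^^ k) z = (f ^^ (k mod p)) (((f ^^ p) ^^ (k div p)) z)" for z
    by (simp add: funpow_mult mult.commute flip: funpow_add_apply)
  have "((f ^^ p) ^^ (k div p)) x = x"
    using funpow_multiple_fixed[OF assms(4)] by (simp add: funpow_mult)
  then show ?thesis
    using funpow_lipschitz_bound[OF assms(1,2), of "k mod p" p] assms(3)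
    by (simp add: split)
qed

text \<open>A start near \<open>x\<close> has the form \<open>(f ^^ j) w\<close> with
  \<open>w\<close> in \<open>C\<close>, possibly out of phase with \<open>x\<close>. The shift is
  harmless when \<open>(f ^^ j) x = x\<close>, since attraction then applies to \<open>w\<close> and
  \<open>x\<close> from time \<open>j\<close> on.\<close>

lemma stable_in_forward_orbits:
  fixes f :: "'a::metric_space \<Rightarrow> 'a"
  assumes lip: "L-lipschitz_on UNIV f" "1 \<le> L"
    and C: "compact C" "(f ^^ p) ` C \<subseteq> C" and p: "0 < p"
    and x: "x \<in> C" "(f ^^ p) x = x"
    and attract: "\<And>e. 0 < e \<Longrightarrow> \<exists>K. \<forall>k\<ge>K. \<forall>z\<in>C. dist ((f ^^ k) z) ((f ^^ k) x) < e"
  shows "stable_in (forward_orbits f C) f x"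
  unfolding stable_in_def
proof (intro conjI allI impI)
  show "x \<in> forward_orbits f C"
    unfolding forward_orbits_def using x(1) by (auto intro!: exI[of _ 0])
  \<comment> \<open>If \<open>x = (f ^^ j) z\<close>, then at all times \<open>j + p * n\<close> the
    solution from \<open>z\<close> is at \<open>x\<close> and the one from \<open>x\<close> is at
    \<open>(f ^^ j) x\<close>. Attraction excludes such a constant positive gap;
    \<open>n = K\<close> is late enough.\<close>
  have fixed: "(f ^^ j) x = x" if j: "x \<in> (f ^^ j) ` C" for j
  proof (rule ccontr)
    assume "(f ^^ j) x \<noteq> x"
    then have "0 < dist x ((f ^^ j) x)" by simp
    then obtain K where
      K: "\<forall>k\<ge>K. \<forall>z\<in>C. dist ((f ^^ k) z) ((f ^^ k) x) < dist x ((f ^^ j) x)"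
      using attract by blast
    obtain z where z: "z \<in> C" "x = (f ^^ j) z" using j by blast
    have "(f ^^ (j + p * K)) z = x"
      using funpow_multiple_fixed[OF x(2), of K] z(2)
      by (metis add.commute funpow_add_apply)
    moreover have "(f ^^ (j + p * K)) x = (f ^^ j) x"
      using funpow_multiple_fixed[OF x(2), of K] by (simp add: funpow_add_apply)
    moreover have "K \<le> j + p * K"
      using p by (simp add: trans_le_add2)
    ultimately show False
      using K z(1) by force
  qed
  have "continuous_on UNIV (f ^^ j)" for j
  proof (induction j)
    case (Suc j)
    then show ?case
      using lipschitz_on_continuous_on[OF lip(1)]
      by (auto intro: continuous_on_compose2[where g = f] simp: comp_def)
  qed (simp add: id_def)
  then have cpt: "compact ((f ^^ j) ` C)" for j
    using C(1) by (meson compact_continuous_image continuous_on_subset subset_UNIV)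
  \<comment> \<open>The pieces that miss \<open>x\<close>: finitely many compact sets, so a whole
    ball around \<open>x\<close> avoids them.\<close>
  define U where "U = (\<Union>j\<in>{j. j < p \<and> x \<notin> (f ^^ j) ` C}. (f ^^ j) ` C)"
  have "closed U"
    unfolding U_def using cpt by (intro closed_UN) (auto intro: compact_imp_closed)
  moreover have "x \<notin> U"
    by (auto simp: U_def)
  ultimately obtain r where r: "0 < r" "\<And>y. dist y x < r \<Longrightarrow> y \<notin> U"
    using open_Compl[of U] unfolding open_dist by blast
  fix e :: real assume e: "0 < e"
  obtain K where K: "\<forall>k\<ge>K. \<forall>z\<in>C. dist ((f ^^ k) z) ((f ^^ k) x) < e"
    using attract[OF e] by blast
  show "\<exists>\<delta>>0. \<forall>y\<in>forward_orbits f C. dist y x < \<delta> \<longrightarrow> (\<forall>k. dist ((f ^^ k) y) ((f ^^ k) x) < e)"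
  \<comment> \<open>The radius \<open>r\<close> excludes the pieces missing \<open>x\<close>. The
    bound \<open>e / L ^ K\<close> settles the times before \<open>K\<close> by the Lipschitz
    estimate; attraction settles the others.\<close>
  proof (intro exI[of _ "min r (e / L ^ K)"] conjI ballI impI allI)
    show "0 < min r (e / L ^ K)" using r(1) e lip(2) by simp
    fix y k assume y: "y \<in> forward_orbits f C" "dist y x < min r (e / L ^ K)"
    then obtain i z where z: "z \<in> C" "y = (f ^^ i) z"
      unfolding forward_orbits_def by auto
    \<comment> \<open>Whole blocks of \<open>p\<close> steps stay in \<open>C\<close> and are
      absorbed into \<open>w\<close>; only a phase \<open>j\<close> below \<open>p\<close> is
      left.\<close>
    define j where "j = i mod p"
    define w where "w = ((f ^^ p) ^^ (i div p)) z"
    have w: "w \<in> C" unfolding w_def using funpow_in[OF C(2) z(1)] .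
    have y_eq: "y = (f ^^ j) w"
      unfolding w_def j_def z(2) by (simp add: funpow_mult mult.commute flip: funpow_add_apply)
    have "y \<notin> U" using r(2) y(2) by simp
    moreover have "y \<in> (f ^^ j) ` C" using w y_eq by blast
    moreover have "j < p" using p by (simp add: j_def)
    ultimately have "x \<in> (f ^^ j) ` C" unfolding U_def by blast
    then have "(f ^^ j) x = x" by (rule fixed)
    show "dist ((f ^^ k) y) ((f ^^ k) x) < e"
    proof (cases "K \<le> k")
      case True
      have "dist ((f ^^ (k + j)) w) ((f ^^ (k + j)) x) < e"
        using K w True by simp
      then show ?thesis
        using \<open>(f ^^ j) x = x\<close> by (simp add: y_eq funpow_add_apply)
    next
      case False
      then have "dist ((f ^^ k) y) ((f ^^ k) x) \<le> L ^ K * dist y x"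
        by (intro funpow_lipschitz_bound[OF lip]) auto
      also have "\<dots> < e"
        using y(2) lip(2) by (simp add: field_simps)
      finally show ?thesis .
    qed
  qed
qed

section \<open>Norms and contractions\<close>

lemma is_norm_zero: "is_norm N \<Longrightarrow> N 0 = 0"
  unfolding is_norm_def by blast

lemma is_norm_sum_le:
  assumes "is_norm N"
  shows "N (sum g A) \<le> (\<Sum>i\<in>A. N (g i))"
proof (induction A rule: infinite_finite_induct)
  case (insert a A)
  have "N (g a + sum g A) \<le> N (g a) + N (sum g A)"
    using assms by (simp add: is_norm_def)
  with insert show ?case by simp
qed (use assms in \<open>auto simp: is_norm_zero\<close>)

lemma is_norm_minus_commute:
  assumes "is_norm N"
  shows "N (x - y) = N (y - x)"
proof -
  have "N ((-1) *\<^sub>R (x - y)) = \<bar>-1\<bar> * N (x - y)"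
    using assms unfolding is_norm_def by blast
  then show ?thesis by simp
qed

text \<open>Expand in the standard basis and use the triangle inequality; the added 1 makes the
  constant visibly positive.\<close>

lemma is_norm_upper_bound:
  fixes N :: "'a::euclidean_space \<Rightarrow> real"
  assumes "is_norm N"
  obtains B where "0 < B" "\<And>x. N x \<le> B * norm x"
proof
  show "0 < 1 + (\<Sum>b\<in>Basis. N b)"
    using assms by (intro add_pos_nonneg sum_nonneg) (auto simp: is_norm_def)
  fix x :: 'a
  have "N x = N (\<Sum>b\<in>Basis. (x \<bullet> b) *\<^sub>R b)"
    by (simp add: euclidean_representation)
  also have "\<dots> \<le> (\<Sum>b\<in>Basis. N ((x \<bullet> b) *\<^sub>R b))"
    by (rule is_norm_sum_le[OF assms])
  also have "\<dots> = (\<Sum>b\<in>Basis. \<bar>x \<bullet> b\<bar> * N b)"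
    using assms by (simp add: is_norm_def)
  also have "\<dots> \<le> (\<Sum>b\<in>Basis. norm x * N b)"
    using assms by (intro sum_mono mult_right_mono) (auto simp: Basis_le_norm is_norm_def)
  also have "\<dots> \<le> (1 + (\<Sum>b\<in>Basis. N b)) * norm x"
    by (simp add: sum_distrib_left algebra_simps)
  finally show "N x \<le> (1 + (\<Sum>b\<in>Basis. N b)) * norm x" .
qed

lemma is_norm_continuous_on:
  fixes N :: "'a::euclidean_space \<Rightarrow> real"
  assumes "is_norm N"
  shows "continuous_on S N"
proof -
  obtain B where B: "0 < B" "\<And>x. N x \<le> B * norm x"
    using is_norm_upper_bound[OF assms] by blast
  have *: "N x - N y \<le> N (x - y)" for x y
  proof -
    have "N ((x - y) + y) \<le> N (x - y) + N y"
      using assms unfolding is_norm_def by blast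
    then show ?thesis by simp
  qed
  have "B-lipschitz_on S N"
  proof (rule lipschitz_onI)
    fix x y
    show "dist (N x) (N y) \<le> B * dist x y"
      using *[of x y] *[of y x] B(2)[of "x - y"] is_norm_minus_commute[OF assms, of x y]
      by (simp add: dist_real_def dist_norm)
  qed (use B in auto)
  then show ?thesis by (rule lipschitz_on_continuous_on)
qed

text \<open>A continuous \<open>N\<close> attains a positive minimum on the compact Euclidean unit
  sphere; homogeneity extends the bound to all vectors.\<close>

lemma is_norm_lower_bound:
  fixes N :: "'a::euclidean_space \<Rightarrow> real"
  assumes "is_norm N"
  obtains c where "0 < c" "\<And>x. c * norm x \<le> N x"
proof -
  have "\<exists>u\<in>sphere 0 1. \<forall>v\<in>sphere 0 1. N u \<le> N (v::'a)"
    by (intro continuous_attains_inf is_norm_continuous_on assms) auto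
  then obtain u where u: "norm u = 1" "\<And>v. norm v = 1 \<Longrightarrow> N u \<le> N v"
    by auto
  show ?thesis
  proof
    have "u \<noteq> 0" using u(1) by auto
    then show "0 < N u"
      using assms unfolding is_norm_def by (metis order_le_less)
    fix x :: 'a
    show "N u * norm x \<le> N x"
    proof (cases "x = 0")
      case False
      have "N u \<le> N (inverse (norm x) *\<^sub>R x)"
        using False by (intro u(2)) simp
      also have "\<dots> = inverse (norm x) * N x"
        using assms by (simp add: is_norm_def)
      finally show ?thesis using False by (simp add: field_simps)
    qed (use assms in \<open>auto simp: is_norm_def\<close>)
  qed
qed

section \<open>Contractions in an arbitrary norm\<close>

lemma sup_mean_contractive_onE:
  assumes "sup_mean_contractive_on C g"
  obtains N q where "is_norm N" "0 \<le> q" "q < 1"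
    "\<And>x y. x \<in> C \<Longrightarrow> y \<in> C \<Longrightarrow> N (g x - g y) \<le> q * N (x - y)"
proof -
  obtain N where N: "is_norm N" "reactivity_on N C g < 0"
    using assms unfolding sup_mean_contractive_on_def by blast
  \<comment> \<open>\<open>enn2real\<close> sends infinity to 0, so \<open>q\<close> represents the
    supremum only once this is known to be below 1. The supremum, and hence \<open>q\<close>, is 0
    when \<open>C\<close> has no two distinct points.\<close>
  define q where "q = enn2real (lipschitz_const_on N C g)"
  have "enn2ereal (lipschitz_const_on N C g) < 1"
    using N(2) unfolding reactivity_on_def 
    by (cases "enn2ereal (lipschitz_const_on N C g)") (auto simp: one_ereal_def zero_ereal_def)
  then have less: "lipschitz_const_on N C g < 1"
    by (simp add: less_ennreal.rep_eq one_ennreal.rep_eq)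
  then have q_eq: "lipschitz_const_on N C g = ennreal q"
    unfolding q_def by (intro ennreal_enn2real[symmetric]) (auto intro: less_trans)
  have q0: "0 \<le> q" unfolding q_def by simp
  have "q < 1" using less q0 unfolding q_eq by simp
  have "N (g x - g y) \<le> q * N (x - y)" if "x \<in> C" "y \<in> C" for x y
  proof (cases "x = y")
    case False
    have "ennreal (N (g x - g y) / N (x - y)) \<le> ennreal q"
      unfolding q_eq[symmetric] lipschitz_const_on_def
      using that False by (intro SUP_upper2[of "(x, y)"]) auto
    then have "N (g x - g y) / N (x - y) \<le> q"
      using q0 by simp
    moreover have "0 < N (x - y)"
      using N(1) False unfolding is_norm_def by (metis order_le_less right_minus_eq)
    ultimately show ?thesis by (simp add: field_simps)
  qed (use N(1) in \<open>simp add: is_norm_zero\<close>)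
  with N(1) q0 \<open>q < 1\<close> show ?thesis by (rule that)
qed

text \<open>Since \<open>g\<close> contracts in \<open>N\<close> and not necessarily in the metric
  of the type, the fixed point is found as a minimiser of the displacement
  \<open>N (g x - x)\<close>: were it not fixed, its image would be displaced strictly less.\<close>

lemma contraction_fixed_point:
  fixes g :: "'a::euclidean_space \<Rightarrow> 'a"
  assumes N: "is_norm N" and q: "q < 1" and C: "compact C" "C \<noteq> {}" "g ` C \<subseteq> C"
    and g: "continuous_on C g"
    and contr: "\<And>x y. x \<in> C \<Longrightarrow> y \<in> C \<Longrightarrow> N (g x - g y) \<le> q * N (x - y)"
  obtains x where "x \<in> C" "g x = x" "\<And>y. y \<in> C \<Longrightarrow> g y = y \<Longrightarrow> y = x"
proof -
  have pos: "0 < N v" if "v \<noteq> 0" for v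
    using N that unfolding is_norm_def by (metis order_le_less)
  have "continuous_on C (\<lambda>x. N (g x - x))"
    by (rule continuous_on_compose2[OF is_norm_continuous_on[OF N, of UNIV]])
      (auto intro!: continuous_intros g)
  then obtain x where x: "x \<in> C" "\<And>y. y \<in> C \<Longrightarrow> N (g x - x) \<le> N (g y - y)"
    using continuous_attains_inf[OF C(1,2)] by blast
  have gx: "g x \<in> C" using x(1) C(3) by blast
  have fixed: "g x = x"
  proof (rule ccontr)
    assume "g x \<noteq> x"
    then have "0 < N (g x - x)" by (intro pos) simp
    moreover have "N (g x - x) \<le> q * N (g x - x)"
      using x(2)[OF gx] contr[OF gx x(1)] by linarith
    ultimately show False using q by simp
  qed
  have "y = x" if "y \<in> C" "g y = y" for y
  proof (rule ccontr)
    assume "y \<noteq> x"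
    then have "0 < N (y - x)" by (intro pos) simp
    then show False
      using contr[OF that(1) x(1)] that(2) fixed q by simp
  qed
  with x(1) fixed show ?thesis by (rule that)
qed

text \<open>The \<open>N\<close>-distance to \<open>x\<close> decays geometrically under
  \<open>f ^^ p\<close>. The constants \<open>B\<close> and \<open>c\<close> translate between
  \<open>N\<close> and the metric, and \<open>L ^ p\<close> pays for the steps between multiples of
  \<open>p\<close>.\<close>

lemma contraction_uniform_attraction:
  fixes f :: "'a::euclidean_space \<Rightarrow> 'a"
  assumes lip: "L-lipschitz_on UNIV f" "1 \<le> L" and p: "0 < p"
    and N: "is_norm N" and q: "0 \<le> q" "q < 1"
    and C: "bounded C" "(f ^^ p) ` C \<subseteq> C"
    and x: "x \<in> C" "(f ^^ p) x = x"
    and contr: "\<And>y. y \<in> C \<Longrightarrow> N ((f ^^ p) y - x) \<le> q * N (y - x)"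
    and e: "0 < e"
  shows "\<exists>K. \<forall>k\<ge>K. \<forall>z\<in>C. dist ((f ^^ k) z) ((f ^^ k) x) < e"
proof -
  obtain B where B: "0 < B" "\<And>x. N x \<le> B * norm x"
    using is_norm_upper_bound[OF N] by blast
  obtain c where c: "0 < c" "\<And>x. c * norm x \<le> N x"
    using is_norm_lower_bound[OF N] by blast
  \<comment> \<open>Bounding all initial distances at once makes the attraction uniform in
    \<open>z\<close>.\<close>
  obtain D where D: "\<And>z. z \<in> C \<Longrightarrow> dist z x \<le> D"
    using C(1) by (metis bounded_any_center dist_commute)
  have iter: "N (((f ^^ p) ^^ n) z - x) \<le> q ^ n * (B * D)" if z: "z \<in> C" for n z
  proof (induction n)
    case 0
    have "N (z - x) \<le> B * norm (z - x)" by (rule B(2))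
    also have "\<dots> \<le> B * D"
      using D[OF z] B(1) by (intro mult_left_mono) (auto simp: dist_norm)
    finally show ?case by simp
  next
    case (Suc n)
    have "N (((f ^^ p) ^^ Suc n) z - x) \<le> q * N (((f ^^ p) ^^ n) z - x)"
      using contr[OF funpow_in[OF C(2) z, of n]] by simp
    also have "\<dots> \<le> q * (q ^ n * (B * D))"
      using Suc q(1) by (rule mult_left_mono)
    finally show ?case by (simp add: mult.assoc)
  qed
  have "(\<lambda>n. L ^ p / c * (q ^ n * (B * D))) \<longlonglongrightarrow> L ^ p / c * (0 * (B * D))"
    using q by (intro tendsto_intros LIMSEQ_realpow_zero) auto
  then have "\<forall>\<^sub>F n in sequentially. L ^ p / c * (q ^ n * (B * D)) < e"
    using e by (intro order_tendstoD(2)) auto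
  then obtain n0 where n0: "\<And>n. n0 \<le> n \<Longrightarrow> L ^ p / c * (q ^ n * (B * D)) < e"
    by (auto simp: eventually_sequentially)
  show ?thesis
  \<comment> \<open>From time \<open>p * n0\<close> on, at least \<open>n0\<close> whole blocks have
    been completed.\<close>
  proof (intro exI[of _ "p * n0"] allI impI ballI)
    fix k z assume k: "p * n0 \<le> k" and z: "z \<in> C"
    let ?n = "k div p"
    have "dist ((f ^^ k) z) ((f ^^ k) x) \<le> L ^ p * dist (((f ^^ p) ^^ ?n) z) x"
      by (rule dist_funpow_le_dist_iterate[OF lip p x(2)])
    also have "\<dots> \<le> L ^ p * (N (((f ^^ p) ^^ ?n) z - x) / c)"
      using c(2)[of "((f ^^ p) ^^ ?n) z - x"] c(1) lip(2)
      by (intro mult_left_mono) (auto simp: dist_norm field_simps)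
    also have "\<dots> \<le> L ^ p * (q ^ ?n * (B * D) / c)"
      using iter[OF z, of ?n] c(1) lip(2) by (intro mult_left_mono divide_right_mono) auto
    also have "\<dots> < e"
      using n0[of ?n] k p by (simp add: less_eq_div_iff_mult_less_eq mult.commute)
    finally show "dist ((f ^^ k) z) ((f ^^ k) x) < e" .
  qed
qed

section \<open>Stability in the whole space\<close>

text \<open>The chain rule gives the derivative; it varies continuously because composition of
  bounded linear maps is bounded bilinear.\<close>

lemma continuously_differentiable_compose:
  assumes "continuously_differentiable f" "continuously_differentiable g"
  shows "continuously_differentiable (f \<circ> g)"
proof -
  obtain f' g' where
    f': "\<And>x. (f has_derivative blinfun_apply (f' x)) (at x)" "continuous_on UNIV f'" and
    g': "\<And>x. (g has_derivative blinfun_apply (g' x)) (at x)" "continuous_on UNIV g'"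
    using assms unfolding continuously_differentiable_def by blast
  have "continuous_on UNIV g"
    using g'(1) by (meson continuous_at_imp_continuous_on has_derivative_continuous)
  then have "continuous_on UNIV (\<lambda>x. f' (g x))"
    using continuous_on_compose2[OF f'(2)] by blast
  then have "continuous_on UNIV (\<lambda>x. f' (g x) o\<^sub>L g' x)"
    using g'(2)
    by (rule bounded_bilinear.continuous_on[OF bounded_bilinear_blinfun_compose])
  moreover have "((f \<circ> g) has_derivative blinfun_apply (f' (g x) o\<^sub>L g' x)) (at x)" for x
    proof -
    have "blinfun_apply (f' (g x) o\<^sub>L g' x) = blinfun_apply (f' (g x)) \<circ> blinfun_apply (g' x)"
      by (simp add: fun_eq_iff)
    then show ?thesis
      using diff_chain_at[OF g'(1) f'(1)] by simp
  qed
  ultimately show ?thesis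
    unfolding continuously_differentiable_def by (intro exI[of _ "\<lambda>x. f' (g x) o\<^sub>L g' x"]) auto
qed

lemma continuously_differentiable_funpow:
  fixes f :: "'a::real_normed_vector \<Rightarrow> 'a"
  assumes "continuously_differentiable f"
  shows "continuously_differentiable (f ^^ n)"
proof (induction n)
  case 0
  have "(id has_derivative blinfun_apply id_blinfun) (at x)" for x :: 'a
    by (simp add: id_def)
  then have "continuously_differentiable (id :: 'a \<Rightarrow> 'a)"
    unfolding continuously_differentiable_def
    by (intro exI[of _ "\<lambda>_. id_blinfun"]) auto
  then show ?case by (simp add: id_def)
next
  case (Suc n)
  then show ?case
    using continuously_differentiable_compose[OF assms] by (simp add: comp_def)
qed

section \<open>Linearization and stability near the fixed point\<close>

text \<open>For small \<open>t > 0\<close> the point \<open>z + t *\<^sub>R h\<close> is still in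
  \<open>C\<close>, so the contraction estimate bounds the difference quotient. Continuity of
  \<open>N\<close> carries the bound to its limit \<open>g' h\<close>.\<close>

lemma derivative_bound_at_interior:
  fixes g :: "'a::euclidean_space \<Rightarrow> 'a"
  assumes N: "is_norm N" and z: "z \<in> interior C"
    and contr: "\<And>x y. x \<in> C \<Longrightarrow> y \<in> C \<Longrightarrow> N (g x - g y) \<le> q * N (x - y)"
    and g': "(g has_derivative g') (at z)"
  shows "N (g' h) \<le> q * N h"
proof -
  have isCont_N: "isCont N v" for v
    using is_norm_continuous_on[OF N, of UNIV] by (simp add: continuous_on_eq_continuous_at)
  have lim: "((\<lambda>t. (g (z + t *\<^sub>R h) - g z) /\<^sub>R t) \<longlongrightarrow> g' h) (at_right 0)"
  proof -
    have "((\<lambda>t. g (z + t *\<^sub>R h)) has_derivative (\<lambda>t. g' (t *\<^sub>R h))) (at 0)"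
      by (rule has_derivative_compose[of "\<lambda>t. z + t *\<^sub>R h" "\<lambda>t. t *\<^sub>R h" 0 UNIV g g'])
        (auto intro!: derivative_eq_intros simp: g')
    moreover have "linear g'"
      using g' by (rule has_derivative_linear)
    ultimately have "((\<lambda>t. g (z + t *\<^sub>R h)) has_vector_derivative g' h) (at 0)"
      unfolding has_vector_derivative_def by (simp add: linear_cmul)
    then have "((\<lambda>t. norm (g (z + t *\<^sub>R h) - g z - t *\<^sub>R g' h) / \<bar>t\<bar>) \<longlongrightarrow> 0) (at 0)"
      unfolding has_vector_derivative_def has_derivative_at by simp
    moreover have "norm (g (z + t *\<^sub>R h) - g z - t *\<^sub>R g' h) / \<bar>t\<bar>
        = norm ((g (z + t *\<^sub>R h) - g z) /\<^sub>R t - g' h)" if "t \<noteq> 0" for t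
    proof -
      have "(g (z + t *\<^sub>R h) - g z) /\<^sub>R t - g' h
          = (g (z + t *\<^sub>R h) - g z - t *\<^sub>R g' h) /\<^sub>R t"
        using that by (simp add: scaleR_diff_right)
      then show ?thesis by (simp add: divide_inverse_commute)
    qed
    ultimately have "((\<lambda>t. norm ((g (z + t *\<^sub>R h) - g z) /\<^sub>R t - g' h)) \<longlongrightarrow> 0) (at 0)"
      by (simp cong: Lim_cong_within)
    then have "((\<lambda>t. (g (z + t *\<^sub>R h) - g z) /\<^sub>R t) \<longlongrightarrow> g' h) (at 0)"
      by (rule LIM_zero_cancel[OF tendsto_norm_zero_cancel])
    then show ?thesis by (simp add: filterlim_at_split)
  qed
  have "((\<lambda>t. z + t *\<^sub>R h) \<longlongrightarrow> z + 0 *\<^sub>R h) (at_right 0)"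
    by (intro tendsto_intros)
  then have "\<forall>\<^sub>F t in at_right 0. z + t *\<^sub>R h \<in> interior C"
    using z by (intro topological_tendstoD) auto
  then have bound: "\<forall>\<^sub>F t in at_right 0. N ((g (z + t *\<^sub>R h) - g z) /\<^sub>R t) \<le> q * N h"
    using eventually_at_right_less[of 0]
  proof eventually_elim
    case (elim t)
    have "N (g (z + t *\<^sub>R h) - g z) \<le> q * N (t *\<^sub>R h)"
      using contr[of "z + t *\<^sub>R h" z] elim(1) z interior_subset by force
    then have "N (g (z + t *\<^sub>R h) - g z) \<le> t * (q * N h)"
      using N elim(2) by (simp add: is_norm_def mult.left_commute)
    moreover have "N ((g (z + t *\<^sub>R h) - g z) /\<^sub>R t) = N (g (z + t *\<^sub>R h) - g z) / t"
      using N elim(2) by (simp add: is_norm_def divide_inverse_commute)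
    ultimately show ?case
      using elim(2) by (simp add: pos_divide_le_eq mult.commute)
  qed
  show ?thesis
    by (rule tendsto_upperbound[OF isCont_tendsto_compose[OF isCont_N lim] bound]) simp
qed

text \<open>The derivative at \<open>x\<close> shrinks \<open>N\<close> by the factor
  \<open>q\<close>, and near \<open>x\<close> the linearization error fits into the remaining share
  \<open>1 - q\<close>. The resulting nonexpansion towards \<open>x\<close> suffices for Lyapunov
  stability.\<close>

lemma contraction_near_fixed_point:
  fixes g :: "'a::euclidean_space \<Rightarrow> 'a"
  assumes N: "is_norm N" and q: "q < 1"
    and smooth: "continuously_differentiable g"
    and x: "x \<in> closure (interior C)" "g x = x"
    and contr: "\<And>x y. x \<in> C \<Longrightarrow> y \<in> C \<Longrightarrow> N (g x - g y) \<le> q * N (x - y)"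
  obtains r where "0 < r" "\<And>y. norm (y - x) < r \<Longrightarrow> N (g y - x) \<le> N (y - x)"
proof -
  obtain g' where g': "\<And>x. (g has_derivative blinfun_apply (g' x)) (at x)" "continuous_on UNIV g'"
    using smooth unfolding continuously_differentiable_def by blast
  obtain B where B: "0 < B" "\<And>x. N x \<le> B * norm x"
    using is_norm_upper_bound[OF N] by blast
  obtain c where c: "0 < c" "\<And>x. c * norm x \<le> N x"
    using is_norm_lower_bound[OF N] by blast
  have bound: "N (g' x h) \<le> q * N h" for h
  proof -
    have "continuous_on UNIV (\<lambda>z. N (blinfun_apply (g' z) h))"
      by (rule continuous_on_compose2[OF is_norm_continuous_on[OF N, of UNIV]])
        (auto intro!: continuous_intros g'(2))
    \<comment> \<open>For fixed \<open>h\<close> the derivative bound is a closed condition on the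
      base point, so it passes from the interior to its closure, where \<open>x\<close>
      lies.\<close>
    then have "closed {z. N (g' z h) \<le> q * N h}"
      by (intro closed_Collect_le continuous_on_const)
    moreover have "interior C \<subseteq> {z. N (g' z h) \<le> q * N h}"
      using derivative_bound_at_interior[OF N _ contr g'(1)] by blast
    ultimately have "closure (interior C) \<subseteq> {z. N (g' z h) \<le> q * N h}"
      by (intro closure_minimal)
    with x(1) show ?thesis by blast
  qed
  \<comment> \<open>Chosen so that passing from \<open>N\<close> to the Euclidean norm via
    \<open>B\<close> and back via \<open>c\<close> leaves an error of at most
    \<open>(1 - q) * N (y - x)\<close>.\<close>
  have "0 < (1 - q) * c / B" using q B(1) c(1) by simp
  then obtain r where r: "0 < r" "\<And>y. norm (y - x) < r \<Longrightarrow>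
      norm (g y - g x - g' x (y - x)) \<le> (1 - q) * c / B * norm (y - x)"
    using g'(1)[of x] unfolding has_derivative_at_alt by blast
  show ?thesis
  proof (rule that[OF r(1)])
    fix y assume y: "norm (y - x) < r"
    have "N (g' x (y - x) + (g y - x - g' x (y - x)))
        \<le> N (g' x (y - x)) + N (g y - x - g' x (y - x))"
      using N unfolding is_norm_def by blast
    then have "N (g y - x) \<le> N (g' x (y - x)) + N (g y - x - g' x (y - x))"
      by simp
    moreover have "N (g y - x - g' x (y - x)) \<le> (1 - q) * N (y - x)"
    proof -
      have "N (g y - x - g' x (y - x)) \<le> B * norm (g y - x - g' x (y - x))"
        by (rule B(2))
      also have "\<dots> \<le> B * ((1 - q) * c / B * norm (y - x))"
        using r(2)[OF y] x(2) B(1) by (intro mult_left_mono) auto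
      also have "\<dots> = (1 - q) * (c * norm (y - x))"
        using B(1) by simp
      also have "\<dots> \<le> (1 - q) * N (y - x)"
        using c(2) q by (intro mult_left_mono) auto
      finally show ?thesis .
    qed
    ultimately show "N (g y - x) \<le> N (y - x)"
      using bound[of "y - x"] by (simp add: algebra_simps)
  qed
qed

text \<open>Here \<open>N (y - x)\<close> acts as a local Lyapunov function for
  \<open>f ^^ p\<close>: small \<open>N\<close>-balls around \<open>x\<close> are mapped into
  themselves.\<close>

lemma stable_in_UNIV_of_iterate:
  fixes f :: "'a::euclidean_space \<Rightarrow> 'a"
  assumes lip: "L-lipschitz_on UNIV f" "1 \<le> L" and p: "0 < p" and N: "is_norm N"
    and x: "(f ^^ p) x = x"
    and r: "0 < r" "\<And>y. norm (y - x) < r \<Longrightarrow> N ((f ^^ p) y - x) \<le> N (y - x)"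
  shows "stable_in UNIV f x"
  unfolding stable_in_def
proof (intro conjI allI impI)
  fix e :: real assume e: "0 < e"
  obtain B where B: "0 < B" "\<And>x. N x \<le> B * norm x"
    using is_norm_upper_bound[OF N] by blast
  obtain c where c: "0 < c" "\<And>x. c * norm x \<le> N x"
    using is_norm_lower_bound[OF N] by blast
  \<comment> \<open>\<open>s\<close> keeps iterates where the nonexpansion holds and leaves room for
    the factor \<open>L ^ p\<close> of the intermediate steps.\<close>
  define s where "s = min r (e / L ^ p)"
  have s: "0 < s" "s \<le> r" "L ^ p * s \<le> e"
    using r(1) e lip(2) by (auto simp: s_def min_def field_simps)
  show "\<exists>\<delta>>0. \<forall>y\<in>UNIV. dist y x < \<delta> \<longrightarrow> (\<forall>k. dist ((f ^^ k) y) ((f ^^ k) x) < e)"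
  \<comment> \<open>With this radius \<open>N (y - x) < c * s\<close>, so every point at no larger
    \<open>N\<close>-distance from \<open>x\<close> is within Euclidean distance
    \<open>s\<close>.\<close>
  proof (intro exI[of _ "c * s / B"] conjI ballI impI allI)
    show "0 < c * s / B" using c(1) s(1) B(1) by simp
    fix y k assume y: "dist y x < c * s / B"
    have small: "norm (w - x) < s" if "N (w - x) \<le> N (y - x)" for w
    proof -
      have "c * norm (w - x) \<le> B * norm (y - x)"
        using that c(2)[of "w - x"] B(2)[of "y - x"] by linarith
      also have "\<dots> < c * s"
        using y B(1) by (simp add: dist_norm field_simps)
      finally show ?thesis using c(1) by simp
    qed
    have iter: "N (((f ^^ p) ^^ n) y - x) \<le> N (y - x)" for n
    proof (induction n)
      case (Suc n)
      have "N ((f ^^ p) (((f ^^ p) ^^ n) y) - x) \<le> N (((f ^^ p) ^^ n) y - x)"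
        using small[OF Suc] s(2) by (intro r(2)) auto
      with Suc show ?case by simp
    qed simp
    have "dist ((f ^^ k) y) ((f ^^ k) x) \<le> L ^ p * dist (((f ^^ p) ^^ (k div p)) y) x"
      by (rule dist_funpow_le_dist_iterate[OF lip p x])
    also have "\<dots> < L ^ p * s"
      using small[OF iter] lip(2) by (simp add: dist_norm)
    finally show "dist ((f ^^ k) y) ((f ^^ k) x) < e"
      using s(3) by linarith
  qed
qed simp

theorem proposition4:
  fixes f :: "real ^ 'm \<Rightarrow> real ^ 'm" and p :: nat and C1 Cp :: "(real ^ 'm) set"
  assumes lipschitz: "\<exists>L. L-lipschitz_on UNIV f"
    and C1_smooth: "continuously_differentiable f"
    and p: "1 \<le> p"
    and subset: "Cp \<subseteq> C1"
    and compact: "compact Cp" "compact C1"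
    and nonempty: "Cp \<noteq> {}"
    and invariant: "(f ^^ p) ` Cp \<subseteq> Cp" "f ` C1 \<subseteq> C1"
    and contractive: "sup_mean_contractive_on Cp (f ^^ p)"
  shows
    "(unique_stable_fixed_point_in (forward_orbits f Cp) f Cp \<or>
      (\<exists>d. 1 < d \<and> d dvd p \<and> stable_periodic_solution_in (forward_orbits f Cp) f C1 d)) \<and>
     (Cp \<subseteq> closure (interior Cp) \<longrightarrow>
      unique_stable_fixed_point_in UNIV f Cp \<or>
      (\<exists>d. 1 < d \<and> d dvd p \<and> stable_periodic_solution_in UNIV f C1 d))"
proof -
  obtain L0 where "L0-lipschitz_on UNIV f" using lipschitz by blast
  \<comment> \<open>A constant of at least 1 has monotone powers, so \<open>L ^ p\<close> bounds the
    expansion over any number of steps up to \<open>p\<close>.\<close>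
  then have lip: "(max 1 L0)-lipschitz_on UNIV f"
    by (rule lipschitz_on_le) simp
  have L: "1 \<le> max 1 L0" by simp
  have p0: "0 < p" using p by simp
  obtain N q where N: "is_norm N" and q: "0 \<le> q" "q < 1"
    and contr: "\<And>x y. x \<in> Cp \<Longrightarrow> y \<in> Cp \<Longrightarrow> N ((f ^^ p) x - (f ^^ p) y) \<le> q * N (x - y)"
    using sup_mean_contractive_onE[OF contractive] by blast
  have smooth: "continuously_differentiable (f ^^ p)"
    by (rule continuously_differentiable_funpow[OF C1_smooth])
  then have "continuous_on Cp (f ^^ p)"
    unfolding continuously_differentiable_def
    by (meson continuous_at_imp_continuous_on has_derivative_continuous)
  then obtain x where x: "x \<in> Cp" "(f ^^ p) x = x"
    and unique: "\<And>y. y \<in> Cp \<Longrightarrow> (f ^^ p) y = y \<Longrightarrow> y = x"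
    using contraction_fixed_point[OF N q(2) compact(1) nonempty invariant(1) _ contr] by blast
  obtain d where d: "d dvd p" "periodic_solution f x d"
    using periodic_point_least_period[OF p0 x(2)] by blast
  \<comment> \<open>The case distinction on \<open>d\<close> is the same for both state spaces; only
    stability depends on \<open>S\<close>. For \<open>d = 1\<close>, uniqueness holds because fixed
    points of \<open>f\<close> are fixed by \<open>f ^^ p\<close>. For \<open>d > 1\<close> the
    orbit may leave \<open>Cp\<close>, but the invariance of \<open>C1\<close> keeps it in
    \<open>C1\<close>.\<close>
  have solution: "unique_stable_fixed_point_in S f Cp \<or>
      (\<exists>d. 1 < d \<and> d dvd p \<and> stable_periodic_solution_in S f C1 d)"
    if stable: "stable_in S f x" for S
  proof (cases "d = 1")
    case True
    then have "f x = x" using d(2) by (simp add: periodic_solution_def)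
    moreover have "y = x" if "y \<in> Cp" "f y = y" for y
      using unique[OF that(1)] funpow_multiple_fixed[of 1 f y p] that(2) by simp
    ultimately show ?thesis
      unfolding unique_stable_fixed_point_in_def using x(1) stable by blast
  next
    case False
    then have "1 < d" using d(2) by (simp add: periodic_solution_def)
    moreover have "(f ^^ k) x \<in> C1" for k
      using funpow_in[OF invariant(2)] x(1) subset by blast
    ultimately show ?thesis
      unfolding stable_periodic_solution_in_def using d stable by blast
  qed
  show ?thesis
  proof (intro conjI impI solution)
    have "N ((f ^^ p) y - x) \<le> q * N (y - x)" if "y \<in> Cp" for y
      using contr[OF that x(1)] x(2) by simp
    then show "stable_in (forward_orbits f Cp) f x"
      using contraction_uniform_attraction[OF lip L p0 N q _ invariant(1) x]
        compact_imp_bounded[OF compact(1)]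
      by (intro stable_in_forward_orbits[OF lip L compact(1) invariant(1) p0 x]) blast
  next
    \<comment> \<open>A thin \<open>Cp\<close> gives no control in transversal directions: every map
      fixing a point is contractive on that singleton, even if it repels nearby points.\<close>
    assume "Cp \<subseteq> closure (interior Cp)"
    then have "x \<in> closure (interior Cp)" using x(1) by blast
    then obtain r where "0 < r" "\<And>y. norm (y - x) < r \<Longrightarrow> N ((f ^^ p) y - x) \<le> N (y - x)"
      using contraction_near_fixed_point[OF N q(2) smooth _ x(2) contr] by blast
    then show "stable_in UNIV f x"
      by (rule stable_in_UNIV_of_iterate[OF lip L p0 N x(2)])
  qed
qed

end
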